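(* For every integer $k\ge 1$, $$G_{1\text{-}2\text{-}3}^{12 \ldots k}(x)=\begin{cases} 0, & \text{if } k\geq 3,\\ x^2C^2(x), & \text{if } k=2,\\ xC^2(x), & \text{if } k=1, \end{cases}$$ where $G_{1\text{-}2\text{-}3}^{12\ldots k}(x)$ is the ordinary generating function $\sum_{n\ge 1}N(n)x^n$, with $N(n)$ the number of permutations of $\{1,\dots,n\}$ that avoid the classical pattern $1\text{-}2\text{-}3$ and begin with the pattern $12\ldots k$.
   Context: A permutation $\pi=\pi_1\cdots\pi_n$ avoids the classical pattern $1\text{-}2\text{-}3$ if there are no indices $a<b<c$ with $\pi_a<\pi_b<\pi_c$. It begins with the pattern $12\ldots k$ if $n\ge k$ and $\pi_1<\pi_2<\cdots<\pi_k$. The empty permutation is not counted. $C(x)=\sum_{n\ge0}C_nx^n=\frac{1-\sqrt{1-4x}}{2x}$ is the generating function of the Catalan numbers $C_n$, and $C^j(x)=(C(x))^j$. *)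

theory Defs
  imports
    "HOL-Computational_Algebra.Formal_Power_Series"
    "HOL-Combinatorics.Multiset_Permutations"
    Complex_Main
begin

text \<open>
  A permutation of \<open>{1..n}\<close> is given in one-line notation, as an element of
  \<^term>\<open>permutations_of_set {1..n}\<close>; list positions are counted from 0.
\<close>

definition avoids_123 :: "nat list \<Rightarrow> bool" where
  "avoids_123 p \<longleftrightarrow>
     \<not> (\<exists>a b c. a < b \<and> b < c \<and> c < length p \<and> p ! a < p ! b \<and> p ! b < p ! c)"

definition begins_increasing :: "nat \<Rightarrow> nat list \<Rightarrow> bool" where
  "begins_increasing k p \<longleftrightarrow> k \<le> length p \<and> sorted_wrt (<) (take k p)"

definition N_123 :: "nat \<Rightarrow> nat \<Rightarrow> nat" where
  "N_123 k n = card {p \<in> permutations_of_set {1..n}. avoids_123 p \<and> begins_increasing k p}"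

definition G_123 :: "nat \<Rightarrow> real fps" where
  "G_123 k = Abs_fps (\<lambda>n. if n \<ge> 1 then real (N_123 k n) else 0)"

text \<open>The division in the next definition is exact, see \<open>catalan_mult\<close>.\<close>

definition catalan :: "nat \<Rightarrow> nat" where
  "catalan n = ((2 * n) choose n) div (n + 1)"

definition catalan_gf :: "real fps" where
  "catalan_gf = Abs_fps (\<lambda>n. real (catalan n))"

lemma catalan_mult: "(n + 1) * catalan n = (2 * n) choose n"
proof -
  have "(n + 1) * ((2 * n) choose (n + 1)) = n * ((2 * n) choose n)"
    using binomial_absorb_comp[of "2 * n" n] binomial_absorption[of n "2 * n"]
    by auto
  then have "n + 1 dvd n * ((2 * n) choose n)"
    by (metis dvd_triv_left)
  moreover have "coprime (n + 1) n"
    by simp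
  ultimately have "n + 1 dvd (2 * n) choose n"
    using coprime_dvd_mult_right_iff by blast
  then show ?thesis
    unfolding catalan_def by (rule dvd_mult_div_cancel)
qed

lemma catalan_Suc: "(n + 2) * catalan (Suc n) = (4 * n + 2) * catalan n"
proof -
  have "(n + 1) * ((2 * n + 2) choose (n + 1)) = 2 * (2 * n + 1) * ((2 * n) choose n)"
  proof -
    have 1: "(n + 1) * ((2 * n + 2) choose (n + 1)) = (2 * n + 2) * ((2 * n + 1) choose n)"
      using Suc_times_binomial_eq[of "2 * n + 1" n] by (simp add: mult.commute)
    have 2: "(n + 1) * ((2 * n + 1) choose n) = (2 * n + 1) * ((2 * n) choose n)"
      using binomial_absorb_comp[of "2 * n + 1" n] by simp
    show ?thesis
      unfolding 1 by (metis 2 distrib_left mult.assoc mult_2 mult_2_right one_add_one mult.commute)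
  qed
  then have "(n + 1) * ((n + 2) * catalan (Suc n)) = 2 * (2 * n + 1) * ((n + 1) * catalan n)"
    using catalan_mult[of "Suc n"] catalan_mult[of n] by simp
  then have "(n + 1) * ((n + 2) * catalan (Suc n)) = (n + 1) * ((4 * n + 2) * catalan n)"
    by (simp add: algebra_simps)
  then show ?thesis
    by (simp only: mult_cancel1) simp
qed

lemma catalan_sqrt_power2:
  includes fps_syntax
  shows "(1 - 2 * fps_X * catalan_gf)\<^sup>2 = 1 - 4 * fps_X"
proof -
  define S where "S = 1 - 2 * fps_X * catalan_gf"
  define T where "T = S\<^sup>2"
  have S0: "S $ 0 = 1"
    by (simp add: S_def mult.assoc)
  have SSuc: "S $ Suc n = - 2 * real (catalan n)" for n
    by (simp add: S_def catalan_gf_def mult.assoc fps_numeral_fps_const)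
  have ode: "(1 - 4 * fps_X) * fps_deriv S = - 2 * S"
  proof (rule fps_ext)
    fix n
    show "((1 - 4 * fps_X) * fps_deriv S) $ n = (- 2 * S) $ n"
    proof (cases n)
      case 0
      then show ?thesis
        by (simp add: S0 SSuc catalan_def fps_numeral_fps_const left_diff_distrib)
    next
      case (Suc m)
      have "real ((m + 2) * catalan (Suc m)) = real ((4 * m + 2) * catalan m)"
        by (simp only: catalan_Suc)
      then show ?thesis
        using Suc
        by (simp add: SSuc fps_numeral_fps_const fps_const_neg left_diff_distrib mult.assoc algebra_simps
            del: fps_const_neg)
    qed
  qed
  have "(1 - 4 * fps_X) * fps_deriv T = 2 * S * ((1 - 4 * fps_X) * fps_deriv S)"
    by (simp add: T_def power2_eq_square algebra_simps)
  then have odeT: "(1 - 4 * fps_X) * fps_deriv T = - 4 * T"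
    by (simp only: ode) (simp add: T_def power2_eq_square algebra_simps)
  have T0: "T $ 0 = 1"
    by (simp add: T_def power2_eq_square S0)
  have rec: "real (Suc n) * T $ Suc n = (4 * real n - 4) * T $ n" for n
    using arg_cong[OF odeT, of "\<lambda>f. f $ n"]
    by (cases n) (simp_all add: fps_numeral_fps_const left_diff_distrib mult.assoc algebra_simps)
  have T1: "T $ Suc 0 = - 4"
    using rec[of 0] T0 by simp
  have T2: "T $ Suc (Suc n) = 0" for n
  proof (induction n)
    case 0
    then show ?case using rec[of "Suc 0"] by simp
  next
    case (Suc n)
    then show ?case using rec[of "Suc (Suc n)"] by simp
  qed
  have "T $ n = (1 - 4 * fps_X) $ n" for n
    using T0 T1 T2[of "n - 2"]
    by (cases n; cases "n - 1") (auto simp: fps_numeral_fps_const fps_X_def)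
  then have "T = 1 - 4 * fps_X"
    by (rule fps_ext)
  then show ?thesis
    by (simp add: T_def S_def)
qed

lemma catalan_gf_closed_form:
  includes fps_syntax
  shows "catalan_gf = (1 - fps_radical (\<lambda>n x. root n x) 2 (1 - 4 * fps_X)) / (2 * fps_X)"
proof -
  let ?S = "1 - 2 * fps_X * catalan_gf"
  have S0: "?S $ 0 = 1"
    by (simp add: mult.assoc)
  have "?S = fps_radical (\<lambda>n x. root n x) (Suc 1) (1 - 4 * fps_X)"
    using radical_unique[of "\<lambda>n x. root n x" 1 "1 - 4 * fps_X" ?S] catalan_sqrt_power2 S0
    by (simp add: numeral_2_eq_2)
  then have "1 - fps_radical (\<lambda>n x. root n x) 2 (1 - 4 * fps_X) = catalan_gf * (2 * fps_X)"
    by (simp add: numeral_2_eq_2 algebra_simps)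
  then show ?thesis
    by simp
qed

end

theory Submission
  imports Defs
begin

text \<open>
  The idea is to build the \<open>1-2-3\<close>-avoiding permutations of \<open>{1..n + 1}\<close> by inserting the maximum
  \<open>n + 1\<close> into a \<open>1-2-3\<close>-avoiding permutation of \<open>{1..n}\<close>. The maximum can only play the role of the
  \<open>3\<close>, so the insertion at position \<open>i\<close> is harmless exactly when the first \<open>i\<close> entries are decreasing
  (\<open>avoids_123_insert_max\<close>). Hence the natural statistic is the length of the initial decreasing run,
  and \<open>card_avoiders_Suc\<close> turns every count of avoiders into a sum over the insertion position.

  Let \<open>d(n, e)\<close> be the number of avoiders whose first \<open>e\<close> entries decrease. After the insertion at
  position \<open>i\<close>, the first \<open>e + 1\<close> entries decrease iff \<open>i > e\<close>, or \<open>i = 0\<close> and the first \<open>e\<close> entries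
  decreased before. This gives \<open>d(n + 1, e + 1) = d(n, e) + d(n, e + 1) + \<dots> + d(n, n)\<close>, the
  recurrence of the ballot numbers, so \<open>d(n, e) = (2n - e choose n) - (2n - e choose n + 1)\<close>. At
  \<open>e = 0\<close> this is the Catalan number \<open>C\<^sub>n\<close>. Therefore \<open>k = 1\<close> gives \<open>C(x) - 1 = x C(x)\<^sup>2\<close>.

  For \<open>k = 2\<close>, an avoider with \<open>n + 1 \<ge> 2\<close> entries begins with an ascent iff its maximum was
  inserted at position 1, which is always allowed. So there are \<open>C\<^sub>n\<close> of them, and the generating
  function is \<open>x (C(x) - 1) = x\<^sup>2 C(x)\<^sup>2\<close>. For \<open>k \<ge> 3\<close> the first three entries are a forbidden pattern.
\<close>

section \<open>Inserting the maximum\<close>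

text \<open>
  This form lets avoidance be treated by structural induction on the list: the first entry can
  only be the \<open>1\<close> of an occurrence.
\<close>

lemma avoids_123_Cons:
  "avoids_123 (x # q) \<longleftrightarrow> avoids_123 q \<and> sorted_wrt (\<lambda>y z. \<not> (x < y \<and> y < z)) q"
proof
  assume av: "avoids_123 (x # q)"
  have "avoids_123 q"
    unfolding avoids_123_def
  proof clarify
    fix a b c
    assume "a < b" "b < c" "c < length q" "q ! a < q ! b" "q ! b < q ! c"
    then have "\<not> avoids_123 (x # q)"
      unfolding avoids_123_def not_not
      by (intro exI[of _ "Suc a"] exI[of _ "Suc b"] exI[of _ "Suc c"]) simp
    then show False
      using av by contradiction
  qed
  moreover have "sorted_wrt (\<lambda>y z. \<not> (x < y \<and> y < z)) q"
    unfolding sorted_wrt_iff_nth_less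
  proof (intro allI impI notI)
    fix b c
    assume "b < c" "c < length q" "x < q ! b \<and> q ! b < q ! c"
    then have "\<not> avoids_123 (x # q)"
      unfolding avoids_123_def not_not
      by (intro exI[of _ 0] exI[of _ "Suc b"] exI[of _ "Suc c"]) simp
    then show False
      using av by contradiction
  qed
  ultimately show "avoids_123 q \<and> sorted_wrt (\<lambda>y z. \<not> (x < y \<and> y < z)) q" ..
next
  assume q: "avoids_123 q \<and> sorted_wrt (\<lambda>y z. \<not> (x < y \<and> y < z)) q"
  show "avoids_123 (x # q)"
    unfolding avoids_123_def
  proof clarify
    fix a b c
    assume *: "a < b" "b < c" "c < length (x # q)"
      "(x # q) ! a < (x # q) ! b" "(x # q) ! b < (x # q) ! c"
    then obtain b' c' where bc: "b = Suc b'" "c = Suc c'"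
      by (metis less_nat_zero_code not0_implies_Suc)
    show False
    proof (cases a)
      case 0
      then show ?thesis
        using * bc q by (auto simp: sorted_wrt_iff_nth_less)
    next
      case (Suc a')
      then show ?thesis
        using * bc q by (auto simp: avoids_123_def)
    qed
  qed
qed

text \<open>
  A maximum can only be the \<open>3\<close> of an occurrence, so it creates one exactly when there is an ascending
  pair to its left.
\<close>

lemma avoids_123_insert_max:
  assumes "\<forall>x \<in> set xs \<union> set ys. x < m"
  shows "avoids_123 (xs @ m # ys) \<longleftrightarrow> avoids_123 (xs @ ys) \<and> sorted_wrt (\<ge>) xs"
  using assms
proof (induction xs)
  case Nil
  have "sorted_wrt (\<lambda>y z. \<not> (m < y \<and> y < z)) ys"
    using Nil by (auto simp: sorted_wrt_iff_nth_less dest!: nth_mem)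
  then show ?case
    by (simp add: avoids_123_Cons)
next
  case (Cons x xs)
  have IH: "avoids_123 (xs @ m # ys) \<longleftrightarrow> avoids_123 (xs @ ys) \<and> sorted_wrt (\<ge>) xs"
    using Cons by simp
  have m: "\<not> m \<le> y" if "y \<in> set xs \<union> set ys" for y
    using Cons.prems that by (simp add: not_le)
  \<comment> \<open>An entry above \<open>x\<close> and left of \<open>m\<close> would complete \<open>x\<close> and \<open>m\<close> to an occurrence.\<close>
  have "sorted_wrt (\<lambda>y z. \<not> (x < y \<and> y < z)) (xs @ m # ys) \<longleftrightarrow>
      sorted_wrt (\<lambda>y z. \<not> (x < y \<and> y < z)) (xs @ ys) \<and> (\<forall>y \<in> set xs. y \<le> x)"
    using Cons.prems m by (auto simp: sorted_wrt_append not_less less_imp_le)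
  then show ?case
    using IH by (auto simp: avoids_123_Cons)
qed

definition insert_at :: "nat \<Rightarrow> 'a \<Rightarrow> 'a list \<Rightarrow> 'a list" where
  "insert_at i m q = take i q @ m # drop i q"

text \<open>
  The weak order \<open>\<ge>\<close> is harmless because the entries of a permutation are distinct, and it is the
  relation that \<open>avoids_123_insert_max\<close> needs for arbitrary lists.
\<close>

definition avoiders :: "nat \<Rightarrow> nat \<Rightarrow> nat list set" where
  "avoiders n e = {p \<in> permutations_of_set {1..n}. avoids_123 p \<and> sorted_wrt (\<ge>) (take e p)}"

lemma finite_avoiders: "finite (avoiders n e)"
  by (simp add: avoiders_def)

lemma avoidersD:
  assumes "q \<in> avoiders n e"
  shows "set q = {1..n}" "distinct q" "length q = n" "avoids_123 q" "sorted_wrt (\<ge>) (take e q)"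
  using assms distinct_card[of q] by (auto simp: avoiders_def permutations_of_set_def)

lemma avoiders_0_eq_1: "avoiders n 0 = avoiders n 1"
proof -
  have "sorted_wrt (\<ge>) (take 1 p)" for p :: "nat list"
    by (cases p) auto
  then show ?thesis
    by (simp add: avoiders_def)
qed

lemma insert_at_permutations:
  assumes "q \<in> permutations_of_set {1..n}"
  shows "insert_at i (Suc n) q \<in> permutations_of_set {1..Suc n}"
proof -
  have q: "set q = {1..n}" "distinct q"
    using assms by (auto simp: permutations_of_set_def)
  have "set (take i q) \<union> set (drop i q) = {1..n}" "set (take i q) \<inter> set (drop i q) = {}"
    using q set_append[of "take i q" "drop i q"] set_take_disj_set_drop_if_distinct[of q i i]
    by (auto simp del: set_append)
  moreover have "Suc n \<notin> set (take i q)" "Suc n \<notin> set (drop i q)"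
    using q(1) by (auto dest!: in_set_takeD in_set_dropD)
  ultimately show ?thesis
    using q by (auto simp: insert_at_def permutations_of_set_def)
qed

lemma avoids_123_insert_at:
  assumes "q \<in> permutations_of_set {1..n}"
  shows "avoids_123 (insert_at i (Suc n) q) \<longleftrightarrow> avoids_123 q \<and> sorted_wrt (\<ge>) (take i q)"
proof -
  have "\<forall>x \<in> set (take i q) \<union> set (drop i q). x < Suc n"
    using assms by (auto simp: permutations_of_set_def dest!: in_set_takeD in_set_dropD)
  then show ?thesis
    unfolding insert_at_def by (simp add: avoids_123_insert_max)
qed

lemma inj_on_insert_at:
  "inj_on (\<lambda>(i, q). insert_at i (Suc n) q) (SIGMA i:{..n}. avoiders n i)"
proof (rule inj_onI, clarify)
  fix i q j r
  assume mem: "i \<le> n" "q \<in> avoiders n i" "j \<le> n" "r \<in> avoiders n j"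
  assume eq: "insert_at i (Suc n) q = insert_at j (Suc n) r"
  note q = avoidersD[OF mem(2)] and r = avoidersD[OF mem(4)]
  have "Suc n \<notin> set (take i q)" "Suc n \<notin> set (drop i q)"
    using q(1) by (auto dest!: in_set_takeD in_set_dropD)
  then have td: "take i q = take j r" "drop i q = drop j r"
    using eq by (auto simp: insert_at_def append_Cons_eq_iff)
  have "i = j"
    using arg_cong[OF td(1), of length] q(3) r(3) mem by simp
  moreover have "q = r"
    by (metis td append_take_drop_id)
  ultimately show "i = j \<and> q = r"
    by simp
qed

lemma image_insert_at:
  "(\<lambda>(i, q). insert_at i (Suc n) q) ` (SIGMA i:{..n}. avoiders n i) = avoiders (Suc n) 0"
proof (intro equalityI subsetI)
  fix p
  assume "p \<in> (\<lambda>(i, q). insert_at i (Suc n) q) ` (SIGMA i:{..n}. avoiders n i)"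
  then show "p \<in> avoiders (Suc n) 0"
    using insert_at_permutations avoids_123_insert_at by (fastforce simp: avoiders_def)
next
  fix p
  assume p: "p \<in> avoiders (Suc n) 0"
  note p' = avoidersD[OF p]
  have "Suc n \<in> set p"
    using p' by simp
  then obtain xs ys where split: "p = xs @ Suc n # ys"
    by (meson split_list)
  have "set (xs @ ys) = set p - {Suc n}"
    using p'(2) by (auto simp: split)
  also have "\<dots> = {1..n}"
    unfolding p'(1) by auto
  finally have q: "xs @ ys \<in> permutations_of_set {1..n}"
    using p'(2) by (auto simp: split permutations_of_set_def)
  have ins: "p = insert_at (length xs) (Suc n) (xs @ ys)"
    by (simp add: split insert_at_def)
  have "xs @ ys \<in> avoiders n (length xs)"
    using q p'(4) avoids_123_insert_at[OF q, of "length xs"] ins by (auto simp: avoiders_def)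
  moreover have "length xs \<le> n"
    using p'(3) by (simp add: split)
  ultimately show "p \<in> (\<lambda>(i, q). insert_at i (Suc n) q) ` (SIGMA i:{..n}. avoiders n i)"
    using ins by (intro image_eqI[of _ _ "(length xs, xs @ ys)"]) auto
qed

text \<open>
  The property \<open>P\<close> is left open since two instances are needed: a decreasing and an increasing
  beginning.
\<close>

lemma card_avoiders_Suc:
  "card {p \<in> avoiders (Suc n) 0. P p} =
    (\<Sum>i\<le>n. card {q \<in> avoiders n i. P (insert_at i (Suc n) q)})"
proof -
  let ?f = "\<lambda>(i, q). insert_at i (Suc n) q"
  let ?A = "SIGMA i:{..n}. {q \<in> avoiders n i. P (insert_at i (Suc n) q)}"
  have "{p \<in> avoiders (Suc n) 0. P p} = ?f ` ?A"
    unfolding image_insert_at[symmetric] by auto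
  moreover have "inj_on ?f ?A"
    by (rule inj_on_subset[OF inj_on_insert_at]) auto
  ultimately have "card {p \<in> avoiders (Suc n) 0. P p} = card ?A"
    by (simp add: card_image)
  also have "\<dots> = (\<Sum>i\<le>n. card {q \<in> avoiders n i. P (insert_at i (Suc n) q)})"
    by (rule card_SigmaI) (simp_all add: finite_avoiders)
  finally show ?thesis .
qed

section \<open>Counting by the initial decreasing run\<close>

text \<open>
  If the maximum is inserted behind at least one but at most \<open>e\<close> entries, then it creates an ascent
  among the first \<open>e + 1\<close> entries; if it goes further back, it does not affect them.
\<close>

lemma card_avoiders_run:
  assumes "e \<le> n"
  shows "card (avoiders (Suc n) (Suc e)) = (\<Sum>i=e..n. card (avoiders n i))"
proof -
  let ?P = "\<lambda>p :: nat list. sorted_wrt (\<ge>) (take (Suc e) p)"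
  let ?S = "\<lambda>i. {q \<in> avoiders n i. ?P (insert_at i (Suc n) q)}"
  have front: "?S 0 = avoiders n e"
  proof -
    have "sorted_wrt (\<ge>) (Suc n # take e q) \<longleftrightarrow> sorted_wrt (\<ge>) (take e q)"
      if "q \<in> permutations_of_set {1..n}" for q
      using that by (auto simp: permutations_of_set_def dest!: in_set_takeD)
    then show ?thesis
      by (auto simp: avoiders_def insert_at_def simp del: sorted_wrt.simps(2))
  qed
  have middle: "?S i = {}" if "1 \<le> i" "i \<le> e" for i
  proof -
    have False if "q \<in> avoiders n i" "?P (insert_at i (Suc n) q)" for q
    proof -
      note q = avoidersD[OF that(1)]
      have len: "length (take i q) = i"
        using q(3) \<open>i \<le> e\<close> assms by simp
      have "Suc n \<in> set (take (Suc e - i) (Suc n # drop i q))"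
        using \<open>i \<le> e\<close> by (simp add: Suc_diff_le)
      moreover have "q ! 0 \<in> set (take i q)"
        using len \<open>1 \<le> i\<close> by (metis gr0I nth_mem nth_take not_one_le_zero)
      moreover have "sorted_wrt (\<ge>) (take i q @ take (Suc e - i) (Suc n # drop i q))"
        using that(2) len \<open>i \<le> e\<close> by (simp add: insert_at_def min_def)
      ultimately have "Suc n \<le> q ! 0"
        by (auto simp only: sorted_wrt_append)
      moreover have "q ! 0 \<in> set q"
        using q(3) \<open>1 \<le> i\<close> \<open>i \<le> e\<close> assms by simp
      ultimately show False
        using q(1) by simp
    qed
    then show ?thesis
      by blast
  qed
  have behind: "?S i = avoiders n i" if "Suc e \<le> i" "i \<le> n" for i
  proof -
    have "?P (insert_at i (Suc n) q)" if "q \<in> avoiders n i" for q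
    proof -
      note q = avoidersD[OF that]
      have "take (Suc e) (insert_at i (Suc n) q) = take (Suc e) (take i q)"
        using q(3) \<open>Suc e \<le> i\<close> \<open>i \<le> n\<close> by (simp add: insert_at_def)
      then show ?thesis
        using q(5) sorted_wrt_take by metis
    qed
    then show ?thesis
      by blast
  qed
  have "avoiders (Suc n) (Suc e) = {p \<in> avoiders (Suc n) 0. ?P p}"
    by (auto simp: avoiders_def)
  then have "card (avoiders (Suc n) (Suc e)) = (\<Sum>i\<le>n. card (?S i))"
    by (simp only: card_avoiders_Suc)
  also have "\<dots> = (\<Sum>i\<in>{0} \<union> {Suc e..n}. card (?S i))"
  proof (rule sum.mono_neutral_right)
    show "\<forall>i\<in>{..n} - ({0} \<union> {Suc e..n}). card (?S i) = 0"
    proof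
      fix i
      assume "i \<in> {..n} - ({0} \<union> {Suc e..n})"
      then have "1 \<le> i" "i \<le> e"
        by auto
      then show "card (?S i) = 0"
        using middle by (simp only: card.empty)
    qed
  qed auto
  also have "\<dots> = card (?S 0) + (\<Sum>i=Suc e..n. card (?S i))"
    by (subst sum.union_disjoint) auto
  also have "\<dots> = card (avoiders n e) + (\<Sum>i=Suc e..n. card (avoiders n i))"
    unfolding front using behind by (intro arg_cong2[of _ _ _ _ "(+)"] refl sum.cong) auto
  also have "\<dots> = (\<Sum>i=e..n. card (avoiders n i))"
    using assms by (simp add: sum.atLeast_Suc_atMost)
  finally show ?thesis .
qed

text \<open>
  The ballot numbers. Passing from \<open>e\<close> to \<open>e + 1\<close> drops one summand of \<open>card_avoiders_run\<close>, so the
  step is Pascal's rule, used downwards from \<open>e = n\<close>. The value at \<open>e = 0\<close> comes from \<open>e = 1\<close>, since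
  a single entry is always decreasing.
\<close>

lemma card_avoiders_ballot:
  assumes "e \<le> n"
  shows "card (avoiders n e) + (2 * n - e choose Suc n) = (2 * n - e choose n)"
  using assms
proof (induction n arbitrary: e)
  case 0
  have "avoiders 0 0 = {[]}"
    by (auto simp: avoiders_def avoids_123_def)
  then show ?case
    using 0 by simp
next
  case (Suc n)
  have pos: "card (avoiders (Suc n) (Suc e)) + (2 * n + 1 - e choose Suc (Suc n)) =
      (2 * n + 1 - e choose Suc n)" if "e \<le> n" for e
    using that
  proof (induction rule: inc_induct)
    case base
    have "card (avoiders (Suc n) (Suc n)) = card (avoiders n n)"
      by (simp add: card_avoiders_run)
    then show ?case
      using Suc.IH[of n] by (simp add: binomial_eq_0)
  next
    case (step e)
    have "card (avoiders (Suc n) (Suc e)) = card (avoiders n e) + card (avoiders (Suc n) (Suc (Suc e)))"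
      using step.hyps by (simp add: card_avoiders_run sum.atLeast_Suc_atMost)
    moreover have "2 * n + 1 - e = Suc (2 * n - e)" "2 * n + 1 - Suc e = 2 * n - e"
      using step.hyps by auto
    ultimately show ?case
      using step.IH Suc.IH[of e] step.hyps by simp
  qed
  show ?case
  proof (cases e)
    case 0
    have "(2 * n + 1 choose n) = (2 * n + 1 choose Suc n)"
      using binomial_symmetric[of n "2 * n + 1"] by simp
    then show ?thesis
      using 0 pos[of 0] avoiders_0_eq_1[of "Suc n"] by simp
  next
    case (Suc e')
    then show ?thesis
      using pos[of e'] Suc.prems by simp
  qed
qed

lemma card_avoiders_catalan: "card (avoiders n 0) = catalan n"
proof -
  let ?a = "card (avoiders n 0)"
  have "Suc n * (2 * n choose Suc n) = n * (2 * n choose n)"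
    using binomial_absorb_comp[of "2 * n" n] binomial_absorption[of n "2 * n"] by auto
  moreover have "Suc n * ?a + Suc n * (2 * n choose Suc n) = Suc n * (2 * n choose n)"
    using card_avoiders_ballot[of 0 n] by (simp only: distrib_left[symmetric]) simp
  ultimately have "Suc n * ?a = (2 * n choose n)"
    by simp
  then have "Suc n * ?a = Suc n * catalan n"
    using catalan_mult[of n] by simp
  then show ?thesis
    by (simp only: mult_cancel1) simp
qed

section \<open>Permutations with an increasing beginning\<close>

lemma N_123_1:
  assumes "n \<ge> 1"
  shows "N_123 1 n = catalan n"
proof -
  have "begins_increasing 1 p" if "p \<in> permutations_of_set {1..n}" for p
    using that assms by (cases p) (auto simp: begins_increasing_def permutations_of_set_def)
  then have "{p \<in> permutations_of_set {1..n}. avoids_123 p \<and> begins_increasing 1 p} = avoiders n 0"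
    by (auto simp: avoiders_def)
  then show ?thesis
    by (simp add: N_123_def card_avoiders_catalan)
qed

lemma begins_increasing_2: "begins_increasing 2 (x # y # p) \<longleftrightarrow> x < y"
  by (simp add: begins_increasing_def numeral_2_eq_2)

text \<open>
  The second entry of an avoider that begins with an ascent is the maximum, so only the insertion at
  position 1 contributes, and there it is unrestricted.
\<close>

lemma N_123_2:
  assumes "n \<ge> 1"
  shows "N_123 2 (Suc n) = catalan n"
proof -
  have *: "begins_increasing 2 (insert_at i (Suc n) q) \<longleftrightarrow> i = 1"
    if "q \<in> avoiders n i" "i \<le> n" for q i
  proof -
    note q = avoidersD[OF that(1)]
    obtain x xs where x: "q = x # xs"
      using q(3) assms by (cases q) auto
    have "x \<le> n"
      using q(1) x by auto
    consider "i = 0" | "i = 1" | j where "i = Suc (Suc j)"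
      by (metis One_nat_def not0_implies_Suc)
    then show ?thesis
    proof cases
      case 1
      then show ?thesis
        using x \<open>x \<le> n\<close> by (simp add: insert_at_def begins_increasing_2)
    next
      case 2
      then show ?thesis
        using x \<open>x \<le> n\<close> by (simp add: insert_at_def begins_increasing_2)
    next
      case 3
      then show ?thesis
        using x q(3,5) \<open>i \<le> n\<close>
        by (cases xs) (auto simp: insert_at_def begins_increasing_2)
    qed
  qed
  have "N_123 2 (Suc n) = card {p \<in> avoiders (Suc n) 0. begins_increasing 2 p}"
    by (simp add: N_123_def avoiders_def)
  also have "\<dots> = (\<Sum>i\<le>n. card {q \<in> avoiders n i. begins_increasing 2 (insert_at i (Suc n) q)})"
    by (rule card_avoiders_Suc)
  also have "\<dots> = (\<Sum>i\<le>n. if i = 1 then card (avoiders n 1) else 0)"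
  proof (rule sum.cong)
    fix i
    assume "i \<in> {..n}"
    then have "{q \<in> avoiders n i. begins_increasing 2 (insert_at i (Suc n) q)} =
        (if i = 1 then avoiders n 1 else {})"
      using * by auto
    then show "card {q \<in> avoiders n i. begins_increasing 2 (insert_at i (Suc n) q)} =
        (if i = 1 then card (avoiders n 1) else 0)"
      by simp
  qed simp
  also have "\<dots> = catalan n"
    using assms by (simp add: card_avoiders_catalan flip: avoiders_0_eq_1[unfolded One_nat_def])
  finally show ?thesis .
qed

lemma N_123_ge_3:
  assumes "k \<ge> 3"
  shows "N_123 k n = 0"
proof -
  have "\<not> avoids_123 p" if "begins_increasing k p" for p
  proof -
    have "k \<le> length p" and sorted: "sorted_wrt (<) (take k p)"
      using that by (auto simp: begins_increasing_def)
    then have "p ! 0 < p ! 1" "p ! 1 < p ! 2"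
      using assms sorted_wrt_nth_less[OF sorted, of 0 1] sorted_wrt_nth_less[OF sorted, of 1 2]
      by auto
    moreover have "2 < length p"
      using \<open>k \<le> length p\<close> assms by simp
    ultimately show ?thesis
      unfolding avoids_123_def not_not by (intro exI[of _ 0] exI[of _ 1] exI[of _ 2]) simp
  qed
  then have "{p \<in> permutations_of_set {1..n}. avoids_123 p \<and> begins_increasing k p} = {}"
    by blast
  then show ?thesis
    unfolding N_123_def by (simp only: card.empty)
qed

section \<open>Generating functions\<close>

text \<open>
  Expanding the square \<open>(1 - 2 x C)\<^sup>2 = 1 - 4 x\<close> gives \<open>4 x (x C\<^sup>2 - C + 1) = 0\<close>, and \<open>4 x\<close> cancels.
\<close>

lemma catalan_gf_quadratic: "fps_X * catalan_gf ^ 2 = catalan_gf - 1"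
proof -
  have "4 * fps_X * (fps_X * catalan_gf ^ 2 - (catalan_gf - 1)) = 0"
    using catalan_sqrt_power2 by (simp add: power2_eq_square algebra_simps)
  then show ?thesis
    by simp
qed

lemma G_123_1: "G_123 1 = catalan_gf - 1"
proof (rule fps_ext)
  show "fps_nth (G_123 1) n = fps_nth (catalan_gf - 1) n" for n
    using N_123_1[of n] by (cases n) (auto simp: G_123_def catalan_gf_def catalan_def[of 0])
qed

lemma G_123_2: "G_123 2 = fps_X * (catalan_gf - 1)"
proof (rule fps_ext)
  fix n
  consider "n = 0" | "n = 1" | m where "n = Suc m" "m \<ge> 1"
  proof (cases n)
    case (Suc m)
    then show ?thesis
      using that by (cases "m = 0") auto
  qed (use that in blast)
  then show "fps_nth (G_123 2) n = fps_nth (fps_X * (catalan_gf - 1)) n"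
  proof cases
    case 1
    then show ?thesis
      by (simp add: G_123_def)
  next
    case 2
    have "\<not> begins_increasing 2 p" if "p \<in> permutations_of_set {1::nat..1}" for p
      using that by (auto simp: begins_increasing_def dest: permutations_of_setD length_finite_permutations_of_set)
    then have "{p \<in> permutations_of_set {1::nat..1}. avoids_123 p \<and> begins_increasing 2 p} = {}"
      by blast
    then have "N_123 2 1 = 0"
      unfolding N_123_def by (simp only: card.empty)
    then show ?thesis
      using 2 by (simp add: G_123_def catalan_gf_def catalan_def)
  next
    case 3
    then show ?thesis
      by (simp add: G_123_def catalan_gf_def N_123_2)
  qed
qed

theorem proposition8:
  fixes k :: nat
  assumes "k \<ge> 1"
  shows "G_123 k =
    (if k \<ge> 3 then 0
     else if k = 2 then fps_X ^ 2 * catalan_gf ^ 2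
     else fps_X * catalan_gf ^ 2)"
proof -
  consider "k \<ge> 3" | "k = 2" | "k = 1"
    using assms by linarith
  then show ?thesis
  proof cases
    case 1
    then show ?thesis
      by (simp add: G_123_def N_123_ge_3 fps_eq_iff)
  next
    case 2
    have "G_123 2 = fps_X * (fps_X * catalan_gf ^ 2)"
      by (simp only: G_123_2 catalan_gf_quadratic)
    then show ?thesis
      using 2 by (simp add: power2_eq_square mult.assoc)
  next
    case 3
    then show ?thesis
      using G_123_1 catalan_gf_quadratic by simp
  qed
qed

end
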